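(* Let $$\beta_{n}(z;\lambda) = (-1)^{n-1} \frac{(\log \lambda)^{n}}{n!} \lambda^{z} \mathcal{B}_{n}(z;\lambda).$$ Let $\lambda \in (0,\infty)$, $\lambda \neq 1$, $\Lambda = 2\pi i/\log\lambda$, $\rho = |1 - \Lambda| = |1 + \Lambda|$ and $\mu = |1 - 2\Lambda|$, so that $1 < \rho < \mu$. Set $\eta = \rho \mu^{-1}$, so $0 < \eta < 1$. Suppose that $\omega = \rho^{-1} (1-\Lambda) = e^{2\pi i \alpha}$ is a root of unity, i.e. $\alpha$ is rational. Let $E(\alpha)\subseteq\mathbb{R}$ be the exceptional set of those $x\in\mathbb{R}$ for which $\cos\bigl(2\pi(x - n\alpha)\bigr) = 0$ for some $n \in \mathbb{N}$. Then for $z = x+iy$ ($x,y\in\mathbb{R}$) in a compact subset $K$ of $\mathbb{C}$ at positive distance $\delta$ from $E(\alpha)$, there is a constant $c = c_{K,\lambda}> 0$ such that $$\rho^{-1} \left( \frac{4\delta}{\cosh 2 \pi y} - c\, \eta^{n} \right) \leq \left| \frac{\beta_{n+1}(z;\lambda)-1}{\beta_{n}(z;\lambda)-1}\right| \leq \rho^{-1} \left( \frac{\cosh 2\pi y}{4\delta} + c\, \eta^{n} \right).$$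
   Context: The Apostol-Bernoulli polynomials $\mathcal{B}_n(x;\lambda)$ ($n\ge 0$, $\lambda\in\mathbb{C}$) are defined by the power series expansion at $z=0$ $$\frac{z e^{xz}}{\lambda e^z-1} = \sum_{n=0}^\infty \mathcal{B}_n(x;\lambda)\, \frac{z^n}{n!}.$$ Here $\log$ is the principal branch of the logarithm (for $\lambda>0$, the real logarithm), and $\lambda^z = e^{z\log\lambda}$.
   Formalization: The bounds are claimed, with one c, for every n such that β_n(z;λ)−1 has no zero on K, which is shown to include all sufficiently large n; for small n the denominator can vanish on K (log λ=2π, n=1, z≈0.7072), and then no c works. *)

theory Defs
  imports "HOL-Analysis.Analysis"
begin

text \<open>
  The Apostol--Bernoulli polynomials, read off from the formal power series
  \<open>X e\<^sup>x\<^sup>X / (\<lambda> e\<^sup>X - 1)\<close>. For \<open>\<lambda> = 1\<close> the denominator has subdegree 1, but so has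
  the numerator, and the division of formal power series is still exact; the lemma below
  gives the analytic form of the definition for every \<open>\<lambda>\<close>.
\<close>

definition apostol_bernoulli :: "nat \<Rightarrow> complex \<Rightarrow> complex \<Rightarrow> complex" where
  "apostol_bernoulli n x l =
     fact n * fps_nth (fps_X * fps_exp x / (fps_const l * fps_exp 1 - 1)) n"

lemma eventually_sums_apostol_bernoulli:
  "eventually (\<lambda>z. (\<lambda>n. apostol_bernoulli n x l * z ^ n / fact n)
     sums (z * exp (x * z) / (l * exp z - 1))) (at 0)"
proof -
  define F :: "complex fps" where "F = fps_X * fps_exp x"
  define G :: "complex fps" where "G = fps_const l * fps_exp 1 - 1"
  define f where "f = (\<lambda>z::complex. z * exp (x * z))"
  define g where "g = (\<lambda>z::complex. l * exp z - 1)"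
  have f: "f has_fps_expansion F" and g: "g has_fps_expansion G"
    unfolding f_def F_def g_def G_def by (intro fps_expansion_intros)+
  have coeff: "fps_nth G 0 = l - 1" "fps_nth G 1 = l"
    by (simp_all add: G_def)
  hence nz: "G \<noteq> 0"
    by (metis diff_0_right diff_self fps_zero_nth one_neq_zero eq_iff_diff_eq_0)
  have "subdegree G \<le> 1"
  proof (cases "l = 0")
    case True
    hence "fps_nth G 0 \<noteq> 0" using coeff by simp
    thus ?thesis by (simp add: subdegree_eq_0)
  next
    case False
    thus ?thesis using coeff by (intro subdegree_leI) simp
  qed
  moreover have "subdegree F = 1"
    by (intro subdegreeI) (auto simp: F_def)
  ultimately have sub: "subdegree G \<le> subdegree F" by simp
  define h where
    "h = (\<lambda>z. if z = 0 then fps_nth F (subdegree G) / fps_nth G (subdegree G) else f z / g z)"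
  have h: "h has_fps_expansion F / G"
    unfolding h_def by (intro has_fps_expansion_divide f g sub nz refl)
  hence r: "fps_conv_radius (F / G) > 0"
    and ev: "eventually (\<lambda>z. eval_fps (F / G) z = h z) (nhds 0)"
    by (auto simp: has_fps_expansion_def)
  have "eventually (\<lambda>z. z \<in> eball 0 (fps_conv_radius (F / G))) (nhds 0)"
    using r by (intro eventually_nhds_in_open) (auto simp: zero_ereal_def)
  with ev have "eventually (\<lambda>z. (\<lambda>n. fps_nth (F / G) n * z ^ n) sums h z) (nhds 0)"
  proof eventually_elim
    case (elim z)
    thus ?case
      using sums_eval_fps[of z "F / G"] by (simp add: in_eball_iff)
  qed
  hence "eventually (\<lambda>z. (\<lambda>n. fps_nth (F / G) n * z ^ n) sums h z) (at 0)"
    by (auto simp: eventually_at_filter elim: eventually_mono)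
  moreover have "eventually (\<lambda>z::complex. z \<noteq> 0) (at 0)"
    by (simp add: eventually_at_filter)
  ultimately show ?thesis
    by eventually_elim
       (simp add: h_def f_def g_def apostol_bernoulli_def F_def G_def)
qed

text \<open>The factor \<open>(-1)\<^sup>n\<^sup>-\<^sup>1\<close> has an integer exponent, since \<open>n = 0\<close> is allowed.\<close>

definition normalized_apostol_bernoulli :: "nat \<Rightarrow> complex \<Rightarrow> complex \<Rightarrow> complex" where
  "normalized_apostol_bernoulli n z l =
     (-1) powi (int n - 1) * (Ln l ^ n / fact n) * l powr z * apostol_bernoulli n z l"

definition exceptional_set :: "real \<Rightarrow> real set" where
  "exceptional_set \<alpha> = {x. \<exists>n::nat. cos (2 * pi * (x - real n * \<alpha>)) = 0}"

end

theory Submission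
  imports Defs "HOL-Complex_Analysis.Residue_Theorem"
begin

text \<open>
  Put \<open>L = log \<lambda>\<close>. For fixed \<open>x\<close> the generating function \<open>z e\<^sup>x\<^sup>z / (\<lambda> e\<^sup>z - 1)\<close> has
  simple poles at the points \<open>2\<pi>ik - L = -L (1 - k\<Lambda>)\<close>, where \<open>k\<close> runs over the integers.
  By the residue theorem its \<open>n\<close>-th Taylor coefficient at 0 equals minus the sum of the
  residues of the generating function divided by \<open>z\<^sup>n\<^sup>+\<^sup>1\<close>, taken over the poles inside a circle,
  plus an integral over the circle that the radius controls. After normalization the pole with
  index \<open>k\<close> contributes \<open>e\<^sup>2\<^sup>\<pi>\<^sup>i\<^sup>k\<^sup>x / (1 - k\<Lambda>)\<^sup>n\<close>, so the pole \<open>k = 0\<close> gives the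
  limit 1, and the error is uniform for \<open>x\<close> in a compact set
  (\<open>normalized_apostol_bernoulli_expansion\<close>).

  The two poles \<open>k = \<plusminus>1\<close> have \<open>1 \<mp> \<Lambda> = \<rho> e\<^sup>\<plusminus>\<^sup>2\<^sup>\<pi>\<^sup>i\<^sup>\<alpha>\<close>, so together they contribute
  \<open>2 \<rho>\<^sup>-\<^sup>n cos (2\<pi>(z - n\<alpha>))\<close>. The poles \<open>k = \<plusminus>2\<close> contribute \<open>O(\<mu>\<^sup>-\<^sup>n)\<close>, and a circle
  between the second and the third pair of poles makes the integral at most of that order. Hence
  \<open>\<rho>\<^sup>n (\<beta>\<^sub>n(z) - 1) = 2 cos (2\<pi>(z - n\<alpha>)) + O(\<eta>\<^sup>n)\<close> uniformly on \<open>K\<close>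
  (\<open>normalized_apostol_bernoulli_asymptotics\<close>).

  It remains to divide two consecutive such expressions. The cosine is at most
  \<open>cosh (2\<pi>y)\<close> in modulus, and it is at least four times the distance of its argument
  \<open>z - n\<alpha>\<close> to the nearest zero of \<open>w \<mapsto> cos (2\<pi>w)\<close> (\<open>norm_cos_ge_distance\<close>), hence at
  least \<open>4\<delta>\<close>. For large \<open>n\<close> the error terms perturb the quotient of these bounds by
  \<open>O(\<eta>\<^sup>n)\<close> (\<open>quotient_perturbation\<close>). Each of the remaining finitely many \<open>n\<close> needs
  only some bound for a continuous function on \<open>K\<close>, which the constant \<open>c\<close> absorbs.
\<close>

section \<open>Poles and Taylor coefficients of the generating function\<close>

text \<open>
  The poles are the points with integer \<open>t\<close>. Real \<open>t\<close> are allowed so that half-integers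
  give radii of circles that separate consecutive poles.
\<close>

definition kernel_pole :: "real \<Rightarrow> real \<Rightarrow> complex" where
  "kernel_pole L t = Complex (- L) (2 * pi * t)"

lemma kernel_denominator_zero_iff:
  assumes "0 < l"
  shows "of_real l * exp z = 1 \<longleftrightarrow> (\<exists>k::int. z = kernel_pole (ln l) (of_int k))"
proof -
  have "of_real l * exp z = 1 \<longleftrightarrow> exp z = exp (of_real (- ln l) :: complex)"
    using assms by (simp only: exp_of_real exp_minus) (simp add: field_simps)
  also have "\<dots> \<longleftrightarrow> (\<exists>k::int. z = kernel_pole (ln l) (of_int k))"
    unfolding exp_eq kernel_pole_def by (simp add: complex_eq_iff algebra_simps)
  finally show ?thesis .
qed

lemma norm_kernel_pole_less_iff: "norm (kernel_pole L s) < norm (kernel_pole L t) \<longleftrightarrow> \<bar>s\<bar> < \<bar>t\<bar>"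
proof -
  have "norm (kernel_pole L t) = sqrt (L\<^sup>2 + (2 * pi)\<^sup>2 * t\<^sup>2)" for t
    by (simp add: kernel_pole_def cmod_def power_mult_distrib)
  thus ?thesis
    using abs_le_square_iff[of t s] by (auto simp: not_le[symmetric])
qed

lemma residue_kernel_at_pole:
  assumes "0 < l" "p \<noteq> 0" "of_real l * exp p = 1"
  shows "residue (\<lambda>z. z * exp (x * z) / (of_real l * exp z - 1) / z ^ Suc n) p = exp (x * p) / p ^ n"
proof -
  have "residue (\<lambda>z. (z * exp (x * z) / z ^ Suc n) / (of_real l * exp z - 1)) p
          = (p * exp (x * p) / p ^ Suc n) / 1"
  proof (rule residue_simple_pole_deriv)
    show "open (ball p (norm p))" "connected (ball p (norm p))" "p \<in> ball p (norm p)"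
      using assms by auto
    show "(\<lambda>z. z * exp (x * z) / z ^ Suc n) holomorphic_on ball p (norm p)"
      by (intro holomorphic_intros) auto
    show "((\<lambda>z. of_real l * exp z - 1) has_field_derivative 1) (at p)"
      using assms(3) by (auto intro!: derivative_eq_intros simp: mult.commute)
  qed (use assms in \<open>auto intro!: holomorphic_intros\<close>)
  moreover have "(\<lambda>z. z * exp (x * z) / (of_real l * exp z - 1) / z ^ Suc n)
      = (\<lambda>z. (z * exp (x * z) / z ^ Suc n) / (of_real l * exp z - 1))"
    by (simp only: divide_divide_eq_left mult.commute)
  ultimately show ?thesis using assms(2) by simp
qed

lemma apostol_bernoulli_eq_deriv:
  assumes "l \<noteq> 1"
  shows "apostol_bernoulli n x l = (deriv ^^ n) (\<lambda>z. z * exp (x * z) / (l * exp z - 1)) 0"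
proof -
  have "(\<lambda>z. z * exp (x * z) / (l * exp z - 1)) has_fps_expansion
          fps_X * fps_exp x / (fps_const l * fps_exp 1 - 1)"
    using assms by (intro fps_expansion_intros) simp_all
  from fps_nth_fps_expansion[OF this, of n] show ?thesis
    unfolding apostol_bernoulli_def by simp
qed

text \<open>
  The residue theorem on a circle that passes between the poles with indices \<open>N\<close> and \<open>N + 1\<close>:
  a Taylor coefficient plus the residues of the enclosed poles is the integral over the circle.
\<close>
lemma apostol_bernoulli_residue_bound:
  fixes l M :: real and x :: complex and N n :: nat
  defines "r \<equiv> norm (kernel_pole (ln l) (N + 1 / 2))"
  assumes l: "0 < l" "l \<noteq> 1"
    and M: "\<And>z. norm z = r \<Longrightarrow> norm (z * exp (x * z) / (of_real l * exp z - 1)) \<le> M" "0 \<le> M"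
  shows "norm (apostol_bernoulli n x (of_real l) / fact n
           + (\<Sum>k\<in>{- int N..int N}. exp (x * kernel_pole (ln l) (of_int k)) / kernel_pole (ln l) (of_int k) ^ n))
         \<le> M / r ^ n"
proof -
  define p where "p = (\<lambda>k::int. kernel_pole (ln l) (of_int k))"
  define S where "S = p ` {- int N..int N}"
  define f where "f = (\<lambda>z. z * exp (x * z) / (of_real l * exp z - 1))"
  \<comment> \<open>\<open>A\<close> is the largest disc around 0 with no poles besides those in \<open>S\<close>; it contains the
      closed disc of radius \<open>r\<close>.\<close>
  define A where "A = ball (0::complex) (norm (kernel_pole (ln l) (N + 1)))"
  have "ln l \<noteq> 0" using l by simp
  hence p0: "p k \<noteq> 0" for k by (simp add: p_def kernel_pole_def complex_eq_iff)
  have inj: "inj p" by (auto simp: inj_def p_def kernel_pole_def)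
  have zero: "of_real l * exp (p k) = 1" for k
    using kernel_denominator_zero_iff[OF l(1)] unfolding p_def by blast
  have inS: "z \<in> S" if z: "z \<in> A" "of_real l * exp z = 1" for z
  proof -
    obtain k :: int where k: "z = p k"
      using z(2) kernel_denominator_zero_iff[OF l(1)] unfolding p_def by blast
    with z(1) have "\<bar>real_of_int k\<bar> < real (N + 1)"
      unfolding A_def p_def by (simp add: norm_kernel_pole_less_iff)
    hence "k \<in> {- int N..int N}" by auto
    thus ?thesis unfolding S_def k by (rule imageI)
  qed
  have "norm ((deriv ^^ n) f 0 / fact n + (\<Sum>z\<in>S. residue (\<lambda>w. f w / w ^ Suc n) z)) \<le> M / r ^ n"
  proof (rule fps_coeff_residues_bound[where A = A and k = "{}"])
    show "cball 0 r \<subseteq> A"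
      unfolding A_def r_def by (subst cball_subset_ball_iff) (simp add: norm_kernel_pole_less_iff)
    show "r > 0" using \<open>ln l \<noteq> 0\<close> by (simp add: r_def kernel_pole_def complex_eq_iff)
    show "f holomorphic_on A - S"
      unfolding f_def using inS by (intro holomorphic_intros) auto
    show "S \<subseteq> ball 0 r"
      unfolding S_def p_def r_def by (auto simp: norm_kernel_pole_less_iff)
    show "0 \<notin> S" using p0 unfolding S_def by force
  qed (use M in \<open>auto simp: A_def S_def f_def\<close>)
  also have "(\<Sum>z\<in>S. residue (\<lambda>w. f w / w ^ Suc n) z) = (\<Sum>k\<in>{- int N..int N}. exp (x * p k) / p k ^ n)"
    using inj residue_kernel_at_pole[OF l(1) p0 zero, of x n] unfolding S_def f_def
    by (subst sum.reindex) (auto intro: inj_on_subset simp del: power_Suc)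
  finally show ?thesis
    unfolding p_def f_def using l by (subst apostol_bernoulli_eq_deriv) simp_all
qed

section \<open>Uniform expansion over the poles\<close>

lemma norm_bounded_on_compact:
  fixes f :: "'a::topological_space \<Rightarrow> 'b::real_normed_vector"
  assumes "compact K" "continuous_on K f"
  obtains B where "\<And>z. z \<in> K \<Longrightarrow> norm (f z) \<le> B"
  using compact_imp_bounded[OF compact_continuous_image[OF assms(2,1)]]
  by (auto simp: bounded_iff)

text \<open>
  The circle through the (not attained) pole position \<open>N + 1/2\<close> encloses exactly the poles with
  \<open>|k| \<le> N\<close>. Its radius is \<open>|log \<lambda>|\<close> times \<open>|1 - (N + 1/2)\<Lambda>|\<close>, and the first factor
  is cancelled by the normalization \<open>(log \<lambda>)\<^sup>n\<close>. Uniformity in \<open>x\<close> holds because the generating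
  function is jointly continuous in \<open>x\<close> and the point of the circle.
\<close>
lemma normalized_apostol_bernoulli_expansion:
  fixes l :: real and \<Lambda> :: complex and K :: "complex set" and N :: nat
  assumes l: "0 < l" "l \<noteq> 1"
    and Lambda: "\<Lambda> = 2 * of_real pi * \<i> / of_real (ln l)"
    and K: "compact K"
  shows "\<exists>C\<ge>0. \<forall>n. \<forall>z\<in>K.
    norm (normalized_apostol_bernoulli n z (of_real l)
          - (\<Sum>k\<in>{- int N..int N}. exp (2 * of_real pi * \<i> * of_int k * z) / (1 - of_int k * \<Lambda>) ^ n))
      \<le> C / norm (1 - of_real (N + 1 / 2) * \<Lambda>) ^ n"
proof -
  define L where "L = ln l"
  define r where "r = norm (kernel_pole L (N + 1 / 2))"
  define f where "f = (\<lambda>x z :: complex. z * exp (x * z) / (of_real l * exp z - 1))"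
  have L: "L \<noteq> 0" using l by (simp add: L_def)
  have pole: "kernel_pole L t = - of_real L * (1 - of_real t * \<Lambda>)" for t
    using L by (simp add: kernel_pole_def complex_eq_iff Lambda L_def)
  have powr: "of_real l powr x = exp (x * of_real L)" for x :: complex
    using l by (simp add: powr_def L_def Ln_of_real)
  \<comment> \<open>A pole on the circle would have an index of modulus \<open>N + 1/2\<close>, which is not an integer.\<close>
  have "of_real l * exp z - 1 \<noteq> 0" if "z \<in> sphere 0 r" for z :: complex
  proof
    assume "of_real l * exp z - 1 = 0"
    then obtain k :: int where "z = kernel_pole L (of_int k)"
      using kernel_denominator_zero_iff[OF l(1)] unfolding L_def by auto
    with that have "\<not> norm (kernel_pole L (of_int k)) < norm (kernel_pole L (N + 1 / 2))"
         "\<not> norm (kernel_pole L (N + 1 / 2)) < norm (kernel_pole L (of_int k))"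
      by (simp_all add: r_def)
    hence "2 * \<bar>real_of_int k\<bar> = real (2 * N + 1)" unfolding norm_kernel_pole_less_iff by simp
    hence "2 * \<bar>k\<bar> = int (2 * N + 1)" by linarith
    thus False by presburger
  qed
  hence "continuous_on (K \<times> sphere 0 r) (\<lambda>w. of_real l powr (fst w) * f (fst w) (snd w))"
    unfolding f_def powr by (intro continuous_intros) auto
  with K obtain C0 where C0: "\<And>w. w \<in> K \<times> sphere 0 r \<Longrightarrow> norm (of_real l powr (fst w) * f (fst w) (snd w)) \<le> C0"
    using norm_bounded_on_compact[OF compact_Times[OF K compact_sphere]] by blast
  \<comment> \<open>The maximum is for empty \<open>K\<close>, where \<open>C0\<close> may be negative.\<close>
  define C where "C = max C0 0"
  have C: "C \<ge> 0" "\<And>x z. x \<in> K \<Longrightarrow> norm z = r \<Longrightarrow> norm (of_real l powr x * f x z) \<le> C"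
    using C0[of "(_, _)"] by (auto simp: C_def le_max_iff_disj)
  show ?thesis
  proof (intro exI[of _ C] conjI allI ballI)
    fix n x assume x: "x \<in> K"
    define E where "E = (of_real l powr x :: complex)"
    define a where "a = apostol_bernoulli n x (of_real l) / fact n"
    have E: "E \<noteq> 0" by (simp add: E_def powr)
    define R where "R = (\<Sum>k\<in>{- int N..int N}. exp (x * kernel_pole L (of_int k)) / kernel_pole L (of_int k) ^ n)"
    define c where "c = (- of_real L) ^ n * E"
    have R_bound: "norm (a + R) \<le> C / norm E / r ^ n"
      unfolding r_def L_def a_def R_def
    proof (intro apostol_bernoulli_residue_bound)
      fix z :: complex assume "norm z = norm (kernel_pole (ln l) (real N + 1 / 2))"
      hence "norm E * norm (f x z) \<le> C"
        using C(2)[OF x, of z] by (simp add: norm_mult r_def L_def E_def)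
      thus "norm (z * exp (x * z) / (of_real l * exp z - 1)) \<le> C / norm E"
        using E unfolding f_def by (simp add: pos_le_divide_eq mult.commute)
    qed (use l C(1) in auto)
    have "(-1) powi (int n - 1) = - ((-1) ^ n :: complex)"
      by (cases n) (simp_all add: power_int_minus)
    hence beta: "normalized_apostol_bernoulli n x (of_real l) = - c * a"
      using l by (simp add: normalized_apostol_bernoulli_def c_def E_def a_def L_def Ln_of_real
          power_minus[of "of_real _"])
    have "exp (2 * of_real pi * \<i> * of_int k * x) / (1 - of_int k * \<Lambda>) ^ n
            = c * (exp (x * kernel_pole L (of_int k)) / kernel_pole L (of_int k) ^ n)" for k :: int
    proof -
      have "x * of_real L + x * kernel_pole L (of_int k) = 2 * of_real pi * \<i> * of_int k * x"
        by (simp add: kernel_pole_def Complex_eq algebra_simps)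
      hence "E * exp (x * kernel_pole L (of_int k)) = exp (2 * of_real pi * \<i> * of_int k * x)"
        unfolding E_def powr by (simp flip: exp_add)
      moreover have "kernel_pole L (of_int k) ^ n = (- of_real L) ^ n * (1 - of_int k * \<Lambda>) ^ n"
        by (simp only: pole power_mult_distrib of_real_of_int_eq)
      ultimately show ?thesis using L by (simp add: c_def field_simps)
    qed
    hence "(\<Sum>k\<in>{- int N..int N}. exp (2 * of_real pi * \<i> * of_int k * x) / (1 - of_int k * \<Lambda>) ^ n) = c * R"
      unfolding R_def sum_distrib_left by (intro sum.cong refl)
    hence "normalized_apostol_bernoulli n x (of_real l)
        - (\<Sum>k\<in>{- int N..int N}. exp (2 * of_real pi * \<i> * of_int k * x) / (1 - of_int k * \<Lambda>) ^ n)
      = - c * (a + R)"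
      by (simp only:) (simp add: beta algebra_simps)
    hence "norm (normalized_apostol_bernoulli n x (of_real l)
        - (\<Sum>k\<in>{- int N..int N}. exp (2 * of_real pi * \<i> * of_int k * x) / (1 - of_int k * \<Lambda>) ^ n))
      = norm c * norm (a + R)"
      by (simp only: norm_mult norm_minus_cancel)
    also have "\<dots> \<le> norm c * (C / norm E / r ^ n)"
      using R_bound by (intro mult_left_mono) simp_all
    also have "\<dots> = C / (r / \<bar>L\<bar>) ^ n"
      using E L by (simp add: c_def norm_mult norm_power field_simps)
    also have "r / \<bar>L\<bar> = norm (1 - of_real (N + 1 / 2) * \<Lambda>)"
      using L unfolding r_def pole by (simp add: norm_mult)
    finally show "norm (normalized_apostol_bernoulli n x (of_real l)
          - (\<Sum>k\<in>{- int N..int N}. exp (2 * of_real pi * \<i> * of_int k * x) / (1 - of_int k * \<Lambda>) ^ n))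
      \<le> C / norm (1 - of_real (N + 1 / 2) * \<Lambda>) ^ n" .
  qed (use C in auto)
qed

section \<open>Bounds for the cosine\<close>

text \<open>By concavity the sine lies above the chord through the endpoints \<open>s = 0\<close> and \<open>s = 1/4\<close>.\<close>
lemma four_mult_le_sin:
  assumes "0 \<le> s" "s \<le> 1 / 4"
  shows "4 * s \<le> sin (2 * pi * s)"
proof -
  have "concave_on {0..1/4} (\<lambda>s. sin (2 * pi * s))"
    by (rule f''_le0_imp_concave[where f' = "\<lambda>s. 2 * pi * cos (2 * pi * s)"
          and f'' = "\<lambda>s. - ((2 * pi)\<^sup>2 * sin (2 * pi * s))"])
       (auto intro!: derivative_eq_intros sin_ge_zero mult_nonneg_nonneg simp: power2_eq_square)
  from concave_onD_Icc'[OF this, of s] assms show ?thesis by simp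
qed

text \<open>
  The zeros of \<open>cos (2\<pi>w)\<close> are the real numbers \<open>1/4 + k/2\<close>. If \<open>s\<close> is the real part of the
  difference of \<open>w\<close> and the nearest zero, then \<open>|cos (2\<pi>w)|\<^sup>2 = sin\<^sup>2 (2\<pi>s) + sinh\<^sup>2 (2\<pi> Im w)\<close>.
  The chord bound gives \<open>16 s\<^sup>2\<close> for the first summand, and \<open>(2\<pi> Im w)\<^sup>2 \<ge> 16 (Im w)\<^sup>2\<close>
  bounds the second, so the constant 4 of the real line remains valid in the complex plane.
\<close>
lemma norm_cos_ge_distance:
  fixes w :: complex and \<delta> :: real
  assumes \<delta>: "\<And>k::int. \<delta> \<le> norm (w - of_real (1 / 4 + of_int k / 2))"
  shows "4 * \<delta> \<le> norm (cos (2 * of_real pi * w))"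
proof -
  define k where "k = \<lfloor>2 * Re w\<rfloor>"
  define s where "s = Re w - (1 / 4 + of_int k / 2)"
  have s: "\<bar>s\<bar> \<le> 1 / 4" unfolding s_def k_def by linarith
  have "\<bar>cos (2 * pi * Re w)\<bar> = \<bar>cos (2 * pi * s + pi / 2 + pi * of_int k)\<bar>"
    by (simp add: s_def algebra_simps add_divide_distrib)
  also have "\<dots> = \<bar>sin (2 * pi * s)\<bar>"
    by (simp add: cos_add sin_add sin_int_times_real cos_int_times_real)
  also have "\<dots> \<ge> 4 * \<bar>s\<bar>"
    using four_mult_le_sin[of "\<bar>s\<bar>"] s by (cases "s \<ge> 0") (auto simp: abs_if)
  finally have "\<bar>4 * s\<bar> \<le> \<bar>cos (2 * pi * Re w)\<bar>" by simp
  hence c: "(4 * s)\<^sup>2 \<le> (cos (2 * pi * Re w))\<^sup>2"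
    by (simp only: abs_le_square_iff)
  have "\<bar>4 * Im w\<bar> \<le> \<bar>2 * pi * Im w\<bar>"
    using mult_right_mono[OF pi_ge_two, of "2 * \<bar>Im w\<bar>"] by (simp add: abs_mult)
  also have "\<dots> \<le> \<bar>(exp (2 * pi * Im w) - inverse (exp (2 * pi * Im w))) / 2\<bar>"
    by (rule real_le_abs_sinh)
  finally have im: "(4 * Im w)\<^sup>2 \<le> (exp (2 * pi * Im w) - inverse (exp (2 * pi * Im w)))\<^sup>2 / 4"
    unfolding abs_le_square_iff by (simp add: power_divide)
  have "(4 * norm (w - of_real (1 / 4 + of_int k / 2)))\<^sup>2 \<le> (norm (cos (2 * of_real pi * w)))\<^sup>2"
  proof -
    have "(norm (w - of_real (1 / 4 + of_int k / 2)))\<^sup>2 = s\<^sup>2 + (Im w)\<^sup>2"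
      by (simp add: cmod_power2 s_def)
    with c im show ?thesis
      unfolding norm_cos_squared by (simp add: power_mult_distrib)
  qed
  hence "4 * norm (w - of_real (1 / 4 + of_int k / 2)) \<le> norm (cos (2 * of_real pi * w))"
    by (rule power2_le_imp_le) simp
  with \<delta>[of k] show ?thesis by linarith
qed

lemma norm_cos_le_cosh_Im: "norm (cos (w :: complex)) \<le> cosh (Im w)"
proof -
  have "norm (cos w) = norm (exp (\<i> * w) + exp (- (\<i> * w))) / 2"
    by (simp add: cos_exp_eq norm_divide)
  also have "\<dots> \<le> (norm (exp (\<i> * w)) + norm (exp (- (\<i> * w)))) / 2"
    by (intro divide_right_mono norm_triangle_ineq) simp
  also have "\<dots> = cosh (Im w)" by (simp add: cosh_field_def add.commute)
  finally show ?thesis .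
qed

section \<open>Quotients of perturbed quantities and uniform constants\<close>

text \<open>
  A single slope serves both directions: \<open>t \<le> v/2\<close> keeps the denominator \<open>v - t\<close> at least
  \<open>v/2\<close>, so the upper bound moves with slope at most \<open>2(u + v)/v\<^sup>2\<close>, the lower one with slope at
  most \<open>(u + v)/u\<^sup>2\<close>, and \<open>v \<le> u\<close> bounds both by \<open>4u/v\<^sup>2\<close>.
\<close>
lemma quotient_perturbation:
  fixes u v t p q :: real
  assumes "0 < v" "v \<le> u" "0 \<le> t" "2 * t \<le> v"
    and p: "v - t \<le> p" "p \<le> u + t" and q: "v - t \<le> q" "q \<le> u + t"
  shows "q / p \<le> u / v + 4 * u / v\<^sup>2 * t" and "v / u - 4 * u / v\<^sup>2 * t \<le> q / p"
proof -
  have p0: "0 < p" "0 < q" using assms by linarith+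
  have uv: "0 < u" using assms by linarith
  have "q / p \<le> (u + t) / (v - t)"
    using assms p0 by (intro frac_le) linarith+
  also have "\<dots> \<le> u / v + 4 * u / v\<^sup>2 * t"
  proof -
    have "(u + t) * v\<^sup>2 \<le> (u * v + 4 * u * t) * (v - t)"
    proof -
      have "(u * v + 4 * u * t) * (v - t) - (u + t) * v\<^sup>2 = t * (u * (v - 2 * t) + v * (u - v) + u * (v - 2 * t))"
        by (simp add: power2_eq_square algebra_simps)
      also have "\<dots> \<ge> 0" using assms uv by (intro mult_nonneg_nonneg add_nonneg_nonneg) auto
      finally show ?thesis by linarith
    qed
    hence "(u + t) / (v - t) \<le> (u * v + 4 * u * t) / v\<^sup>2"
      using assms by (simp add: field_simps)
    also have "\<dots> = u / v + 4 * u / v\<^sup>2 * t" using assms by (simp add: field_simps power2_eq_square)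
    finally show ?thesis .
  qed
  finally show "q / p \<le> u / v + 4 * u / v\<^sup>2 * t" .
  have "v / u - (u + v) / u\<^sup>2 * t \<le> (v - t) / (u + t)"
  proof -
    have "(v * u - (u + v) * t) * (u + t) \<le> (v - t) * u\<^sup>2"
    proof -
      have "(v - t) * u\<^sup>2 - (v * u - (u + v) * t) * (u + t) = (u + v) * t\<^sup>2"
        by (simp add: power2_eq_square algebra_simps)
      also have "\<dots> \<ge> 0" using assms uv by auto
      finally show ?thesis by linarith
    qed
    hence "(v * u - (u + v) * t) / u\<^sup>2 \<le> (v - t) / (u + t)"
      using assms uv by (simp add: field_simps)
    moreover have "(v * u - (u + v) * t) / u\<^sup>2 = v / u - (u + v) / u\<^sup>2 * t"
      using uv by (simp add: field_simps power2_eq_square)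
    ultimately show ?thesis by simp
  qed
  moreover have "(u + v) / u\<^sup>2 * t \<le> 4 * u / v\<^sup>2 * t"
    using assms uv by (intro mult_right_mono frac_le power_mono) auto
  moreover have "(v - t) / (u + t) \<le> q / p"
    using assms p0 by (intro frac_le) linarith+
  ultimately show "v / u - 4 * u / v\<^sup>2 * t \<le> q / p" by linarith
qed


text \<open>
  The constant for all large \<open>n\<close> and the finitely many constants for small \<open>n\<close> have a common
  upper bound. This separates the asymptotic estimate from the small indices.
\<close>
lemma uniform_constant_if_eventually:
  fixes P :: "real \<Rightarrow> nat \<Rightarrow> bool"
  assumes mono: "\<And>c d n. P c n \<Longrightarrow> c \<le> d \<Longrightarrow> P d n"
    and ev: "eventually (P c0) sequentially" and each: "\<And>n. \<exists>c. P c n"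
  shows "\<exists>c>0. \<forall>n. P c n"
proof -
  obtain m where m: "\<And>n. n \<ge> m \<Longrightarrow> P c0 n" using ev unfolding eventually_sequentially by blast
  obtain f where f: "\<And>n. P (f n) n" using each by metis
  define c where "c = 1 + \<bar>c0\<bar> + (\<Sum>n<m. \<bar>f n\<bar>)"
  have s: "0 \<le> (\<Sum>n<m. \<bar>f n\<bar>)" by (intro sum_nonneg) auto
  have "P c n" for n
  proof (cases "n < m")
    case True
    hence "\<bar>f n\<bar> \<le> (\<Sum>n<m. \<bar>f n\<bar>)" by (intro member_le_sum) auto
    hence "f n \<le> c" by (simp add: c_def)
    thus ?thesis using mono f by blast
  next
    case False
    moreover have "c0 \<le> c" using s unfolding c_def by linarith
    ultimately show ?thesis using mono m by (meson not_less)
  qed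
  moreover have "c > 0" using s unfolding c_def by linarith
  ultimately show ?thesis by blast
qed

section \<open>The leading oscillation\<close>

lemma norm_one_minus_real_mult:
  fixes \<Lambda> :: complex
  assumes "\<Lambda> = 2 * of_real pi * \<i> / of_real L"
  shows "norm (1 - of_real t * \<Lambda>) = sqrt (1 + (2 * pi / L)\<^sup>2 * t\<^sup>2)"
proof -
  have "1 - of_real t * \<Lambda> = Complex 1 (- (2 * pi / L * t))"
    unfolding assms by (simp add: complex_eq_iff)
  thus ?thesis by (simp add: cmod_def power_mult_distrib power_divide)
qed

text \<open>
  The terms \<open>k = \<plusminus>2\<close> are taken out of the expansion explicitly and only then estimated: stopping at
  \<open>k = \<plusminus>1\<close> would force a circle of radius below \<open>\<mu> |log \<lambda>|\<close> and thus a worse rate than \<open>(\<rho>/\<mu>)\<^sup>n\<close>.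
\<close>
lemma normalized_apostol_bernoulli_asymptotics:
  fixes l \<rho> \<mu> \<alpha> :: real and \<Lambda> :: complex and K :: "complex set"
  assumes l: "0 < l" "l \<noteq> 1"
    and Lambda: "\<Lambda> = 2 * of_real pi * \<i> / of_real (ln l)"
    and rho: "\<rho> = norm (1 - \<Lambda>)"
    and mu: "\<mu> = norm (1 - 2 * \<Lambda>)"
    and alpha: "1 - \<Lambda> = of_real \<rho> * exp (2 * of_real pi * \<i> * of_real \<alpha>)"
    and K: "compact K"
  shows "\<exists>C\<ge>0. \<forall>n. \<forall>z\<in>K.
    norm (of_real (\<rho> ^ n) * (normalized_apostol_bernoulli n z (of_real l) - 1)
          - 2 * cos (2 * of_real pi * (z - of_real (real n * \<alpha>)))) \<le> C * (\<rho> / \<mu>) ^ n"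
proof -
  define e where "e = (\<lambda>(k::int) n z. exp (2 * of_real pi * \<i> * of_int k * z) / (1 - of_int k * \<Lambda>) ^ n)"
  define \<nu> where "\<nu> = norm (1 - of_real (5 / 2) * \<Lambda>)"
  have norms: "norm (1 - of_real t * \<Lambda>) = sqrt (1 + (2 * pi / ln l)\<^sup>2 * t\<^sup>2)" for t
    by (rule norm_one_minus_real_mult[OF Lambda])
  have rho0: "0 < \<rho>" unfolding rho using norms[of 1] by (simp add: add_pos_nonneg)
  have mu0: "0 < \<mu>" unfolding mu using norms[of 2] by (simp add: add_pos_nonneg)
  have mu': "norm (1 + 2 * \<Lambda>) = \<mu>"
    unfolding mu using norms[of 2] norms[of "-2"] by simp
  have "\<mu> \<le> \<nu>"
  proof -
    have "\<mu> = sqrt (1 + (2 * pi / ln l)\<^sup>2 * 2\<^sup>2)"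
      unfolding mu norms[of 2, symmetric] by simp
    also have "\<dots> \<le> \<nu>"
      unfolding \<nu>_def norms real_sqrt_le_iff add_le_cancel_left
      by (intro mult_left_mono) (simp_all add: power2_eq_square)
    finally show ?thesis .
  qed
  have "\<exists>C\<ge>0. \<forall>n. \<forall>z\<in>K.
      norm (normalized_apostol_bernoulli n z (of_real l) - (\<Sum>k\<in>{-2..2}. e k n z)) \<le> C / \<nu> ^ n"
    using normalized_apostol_bernoulli_expansion[OF l Lambda K, of 2]
    unfolding \<nu>_def e_def by simp
  then obtain C where C: "0 \<le> C" "\<And>n z. z \<in> K \<Longrightarrow>
      norm (normalized_apostol_bernoulli n z (of_real l) - (\<Sum>k\<in>{-2..2}. e k n z)) \<le> C / \<nu> ^ n"
    by blast
  obtain B where B: "\<And>z. z \<in> K \<Longrightarrow> norm z \<le> B"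
    using norm_bounded_on_compact[OF K continuous_on_id] by blast
  define D where "D = exp (4 * pi * B)"
  have "{-2..2::int} = {-2,-1,0,1,2}" by auto
  hence sum5: "(\<Sum>k\<in>{-2..2}. e k n z) = 1 + e 1 n z + e (-1) n z + (e 2 n z + e (-2) n z)" for n z
    by (simp add: e_def)
  have e1: "of_real (\<rho> ^ n) * e 1 n z = exp (\<i> * (2 * of_real pi * (z - of_real (real n * \<alpha>))))" for n z
  proof -
    have "(1 - \<Lambda>) ^ n = of_real (\<rho> ^ n) * exp (2 * of_real pi * \<i> * of_real (real n * \<alpha>))"
      unfolding alpha power_mult_distrib exp_of_nat_mult[symmetric] by (simp add: algebra_simps)
    thus ?thesis using rho0 by (simp add: e_def exp_diff[symmetric] algebra_simps)
  qed
  have "1 + \<Lambda> = cnj (1 - \<Lambda>)" unfolding Lambda by simp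
  hence alpha': "1 + \<Lambda> = of_real \<rho> * exp (- (2 * of_real pi * \<i> * of_real \<alpha>))"
    unfolding alpha by (simp add: exp_cnj)
  have e2: "of_real (\<rho> ^ n) * e (-1) n z = exp (- (\<i> * (2 * of_real pi * (z - of_real (real n * \<alpha>)))))" for n z
  proof -
    have "(1 + \<Lambda>) ^ n = of_real (\<rho> ^ n) * exp (- (2 * of_real pi * \<i> * of_real (real n * \<alpha>)))"
      unfolding alpha' power_mult_distrib exp_of_nat_mult[symmetric] by (simp add: algebra_simps)
    thus ?thesis using rho0 by (simp add: e_def exp_diff[symmetric] algebra_simps)
  qed
  have e_le: "norm (e k n z) \<le> D / \<mu> ^ n" if "z \<in> K" "k = 2 \<or> k = -2" for k n z
  proof -
    have "norm (exp (2 * of_real pi * \<i> * of_int k * z)) = exp (- (2 * pi * of_int k * Im z))"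
      by simp
    also have "\<dots> \<le> D"
    proof -
      have "- (2 * pi * of_int k * Im z) \<le> \<bar>- (2 * pi * of_int k * Im z)\<bar>" by (rule abs_ge_self)
      also have "\<dots> = 4 * pi * \<bar>Im z\<bar>" using that(2) by (auto simp: abs_mult)
      also have "\<dots> \<le> 4 * pi * B"
        using B[OF that(1)] abs_Im_le_cmod[of z] by (intro mult_left_mono) auto
      finally show ?thesis by (simp add: D_def)
    qed
    finally have "norm (exp (2 * of_real pi * \<i> * of_int k * z)) \<le> D" .
    moreover have "norm (1 - of_int k * \<Lambda>) = \<mu>" using that(2) mu mu' by auto
    ultimately show ?thesis
      using mu0 by (simp add: e_def norm_divide norm_power divide_right_mono)
  qed
  show ?thesis
  proof (intro exI[of _ "C + 2 * D"] conjI allI ballI)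
    show "0 \<le> C + 2 * D" using C by (simp add: D_def)
    fix n z assume z: "z \<in> K"
    define b where "b = normalized_apostol_bernoulli n z (of_real l)"
    have "2 * cos (2 * of_real pi * (z - of_real (real n * \<alpha>))) = of_real (\<rho> ^ n) * (e 1 n z + e (-1) n z)"
      unfolding distrib_left e1 e2 cos_exp_eq by simp
    hence "of_real (\<rho> ^ n) * (b - 1) - 2 * cos (2 * of_real pi * (z - of_real (real n * \<alpha>)))
          = of_real (\<rho> ^ n) * ((b - (\<Sum>k\<in>{-2..2}. e k n z)) + (e 2 n z + e (-2) n z))"
      unfolding sum5 by (simp add: algebra_simps)
    also have "norm \<dots> = \<rho> ^ n * norm ((b - (\<Sum>k\<in>{-2..2}. e k n z)) + (e 2 n z + e (-2) n z))"
      using rho0 by (simp add: norm_mult norm_power)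
    also have "\<dots> \<le> \<rho> ^ n * (C / \<nu> ^ n + (D / \<mu> ^ n + D / \<mu> ^ n))"
      using C(2)[OF z, of n] e_le[OF z] rho0 unfolding b_def
      by (intro mult_left_mono norm_triangle_mono) auto
    also have "\<dots> \<le> \<rho> ^ n * (C / \<mu> ^ n + (D / \<mu> ^ n + D / \<mu> ^ n))"
      using rho0 mu0 \<open>\<mu> \<le> \<nu>\<close> C(1)
      by (intro mult_left_mono add_right_mono divide_left_mono power_mono mult_pos_pos zero_less_power) auto
    also have "\<dots> = (C + 2 * D) * (\<rho> / \<mu>) ^ n"
      by (simp add: power_divide add_divide_distrib algebra_simps)
    finally show "norm (of_real (\<rho> ^ n) * (normalized_apostol_bernoulli n z (of_real l) - 1)
          - 2 * cos (2 * of_real pi * (z - of_real (real n * \<alpha>)))) \<le> (C + 2 * D) * (\<rho> / \<mu>) ^ n"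
      unfolding b_def .
  qed
qed

text \<open>
  For \<open>\<lambda> \<noteq> 1\<close> the denominator is a unit among the power series, so \<open>x\<close> enters only through the
  coefficients of \<open>e\<^sup>x\<^sup>X\<close> and the Apostol--Bernoulli polynomial is visibly a polynomial in \<open>x\<close>.
\<close>
lemma continuous_on_apostol_bernoulli:
  assumes "l \<noteq> 1"
  shows "continuous_on A (\<lambda>x. apostol_bernoulli n x l)"
proof -
  define G where "G = fps_const l * fps_exp 1 - 1"
  have "fps_nth G 0 \<noteq> 0" using assms by (simp add: G_def)
  hence "fps_X * fps_exp x / G = fps_exp x * (fps_X * inverse G)" for x
    by (simp add: fps_divide_unit mult_ac)
  hence "apostol_bernoulli n x l = fact n * (\<Sum>i=0..n. x ^ i / fact i * fps_nth (fps_X * inverse G) (n - i))" for x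
    by (simp add: apostol_bernoulli_def G_def fps_mult_nth)
  thus ?thesis by (simp only:) (intro continuous_intros, simp)
qed

lemma continuous_on_normalized_apostol_bernoulli:
  fixes l :: real
  assumes "0 < l" "l \<noteq> 1"
  shows "continuous_on A (\<lambda>z. normalized_apostol_bernoulli n z (of_real l))"
  using assms unfolding normalized_apostol_bernoulli_def powr_def
  by (auto intro!: continuous_intros continuous_on_apostol_bernoulli)

section \<open>Quotients of consecutive deviations from the limit\<close>

theorem proposition10:
  fixes l \<rho> \<mu> \<eta> \<alpha> \<delta> :: real and \<Lambda> \<omega> :: complex
    and K :: "complex set" and \<beta> :: "nat \<Rightarrow> complex \<Rightarrow> complex"
  assumes l: "0 < l" "l \<noteq> 1"
    and beta: "\<beta> = (\<lambda>n z. normalized_apostol_bernoulli n z (of_real l))"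
    and Lambda: "\<Lambda> = 2 * of_real pi * \<i> / of_real (ln l)"
    and rho: "\<rho> = norm (1 - \<Lambda>)"
    and mu: "\<mu> = norm (1 - 2 * \<Lambda>)"
    and eta: "\<eta> = \<rho> / \<mu>"
    and omega: "\<omega> = (1 - \<Lambda>) / of_real \<rho>"
    and alpha: "\<omega> = exp (2 * of_real pi * \<i> * of_real \<alpha>)" "\<alpha> \<in> \<rat>"
    and K: "compact K"
    and delta: "\<delta> = setdist K (of_real ` exceptional_set \<alpha>)" "\<delta> > 0"
  shows "\<rho> = norm (1 + \<Lambda>) \<and> 1 < \<rho> \<and> \<rho> < \<mu> \<and> 0 < \<eta> \<and> \<eta> < 1 \<and>
    (\<exists>c>0.
      (\<forall>\<^sub>F n in sequentially. \<forall>z\<in>K. \<beta> n z \<noteq> 1) \<and>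
      (\<forall>n. (\<forall>z\<in>K. \<beta> n z \<noteq> 1) \<longrightarrow>
        (\<forall>z\<in>K.
          1 / \<rho> * (4 * \<delta> / cosh (2 * pi * Im z) - c * \<eta> ^ n)
            \<le> norm ((\<beta> (n + 1) z - 1) / (\<beta> n z - 1)) \<and>
          norm ((\<beta> (n + 1) z - 1) / (\<beta> n z - 1))
            \<le> 1 / \<rho> * (cosh (2 * pi * Im z) / (4 * \<delta>) + c * \<eta> ^ n))))"
proof -
  note norms = norm_one_minus_real_mult[OF Lambda]
  have a: "0 < (2 * pi / ln l)\<^sup>2" using l by simp
  have rho': "\<rho> = norm (1 + \<Lambda>)" unfolding rho using norms[of 1] norms[of "-1"] by simp
  have rho1: "1 < \<rho>" unfolding rho using norms[of 1] a by simp
  have rhomu: "\<rho> < \<mu>" unfolding rho mu using norms[of 1] norms[of 2] a by simp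
  have eta01: "0 < \<eta>" "\<eta> < 1" using rho1 rhomu unfolding eta by (simp_all add: field_simps)
  have "1 - \<Lambda> = of_real \<rho> * exp (2 * of_real pi * \<i> * of_real \<alpha>)"
    using alpha(1) omega rho1 by (simp add: field_simps)
  then obtain C where C: "0 \<le> C" "\<And>n z. z \<in> K \<Longrightarrow>
      norm (of_real (\<rho> ^ n) * (\<beta> n z - 1) - 2 * cos (2 * of_real pi * (z - of_real (real n * \<alpha>)))) \<le> C * \<eta> ^ n"
    using normalized_apostol_bernoulli_asymptotics[OF l Lambda rho mu _ K] unfolding beta eta by blast
  have cos_ge: "8 * \<delta> \<le> norm (2 * cos (2 * of_real pi * (z - of_real (real n * \<alpha>))))" if "z \<in> K" for n z
  proof -
    have "\<delta> \<le> norm (z - of_real (real n * \<alpha>) - of_real (1 / 4 + of_int k / 2))" for k :: int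
    proof -
      define x where "x = real n * \<alpha> + (1 / 4 + of_int k / 2)"
      have "cos (2 * pi * (x - real n * \<alpha>)) = cos (pi / 2 + pi * of_int k)"
        by (simp add: x_def algebra_simps)
      also have "\<dots> = 0" by (simp add: cos_add sin_int_times_real)
      finally have "x \<in> exceptional_set \<alpha>" unfolding exceptional_set_def by blast
      hence "\<delta> \<le> dist z (of_real x)" unfolding delta using that by (intro setdist_le_dist) auto
      thus ?thesis by (simp add: dist_norm x_def diff_diff_eq)
    qed
    from norm_cos_ge_distance[OF this] show ?thesis by (simp add: norm_mult)
  qed
  have cos_le: "norm (2 * cos (2 * of_real pi * (z - of_real (real n * \<alpha>)))) \<le> 2 * cosh (2 * pi * Im z)" for n z
    using norm_cos_le_cosh_Im[of "2 * of_real pi * (z - of_real (real n * \<alpha>))"] by (simp add: norm_mult)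
  \<comment> \<open>Rescaling by \<open>\<rho>\<^sup>n\<close> leaves a quantity of bounded size; the quotient of consecutive ones
      differs from the wanted quotient by the factor \<open>\<rho>\<close>.\<close>
  define p where "p = (\<lambda>n z. norm (of_real (\<rho> ^ n) * (\<beta> n z - 1)))"
  have p_bounds: "8 * \<delta> - C * \<eta> ^ n \<le> p n z" "p n z \<le> 2 * cosh (2 * pi * Im z) + C * \<eta> ^ n"
    if "z \<in> K" for n z
    using C(2)[OF that, of n] cos_ge[OF that, of n] cos_le[of z n]
      norm_triangle_ineq3[of "of_real (\<rho> ^ n) * (\<beta> n z - 1)" "2 * cos (2 * of_real pi * (z - of_real (real n * \<alpha>)))"]
    unfolding p_def by linarith+
  have ratio: "norm ((\<beta> (n + 1) z - 1) / (\<beta> n z - 1)) = 1 / \<rho> * (p (n + 1) z / p n z)" for n z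
    using rho1 by (simp add: p_def norm_mult norm_divide norm_power)
  have "(\<lambda>n. C * \<eta> ^ n) \<longlonglongrightarrow> C * 0"
    using eta01 by (intro tendsto_intros LIMSEQ_power_zero) auto
  hence small: "eventually (\<lambda>n. C * \<eta> ^ n < 4 * \<delta>) sequentially"
    using delta(2) by (intro order_tendstoD(2)) auto
  have ne: "eventually (\<lambda>n. \<forall>z\<in>K. \<beta> n z \<noteq> 1) sequentially"
    using small
  proof eventually_elim
    case (elim n)
    show ?case
    proof
      fix z assume "z \<in> K"
      hence "0 < p n z" using p_bounds(1)[of z n] elim delta(2) by linarith
      thus "\<beta> n z \<noteq> 1" by (auto simp: p_def)
    qed
  qed
  have "continuous_on K (\<lambda>z. cosh (2 * pi * Im z))" by (intro continuous_intros)
  then obtain H where "\<And>z. z \<in> K \<Longrightarrow> norm (cosh (2 * pi * Im z)) \<le> H"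
    using norm_bounded_on_compact[OF K] by blast
  hence H: "cosh (2 * pi * Im z) \<le> H" if "z \<in> K" for z using that by simp
  define P where "P = (\<lambda>c n. (\<forall>z\<in>K. \<beta> n z \<noteq> 1) \<longrightarrow> (\<forall>z\<in>K.
    4 * \<delta> / cosh (2 * pi * Im z) - c * \<eta> ^ n \<le> p (n + 1) z / p n z \<and>
    p (n + 1) z / p n z \<le> cosh (2 * pi * Im z) / (4 * \<delta>) + c * \<eta> ^ n))"
  have "\<exists>c>0. \<forall>n. P c n"
  proof (rule uniform_constant_if_eventually)
    fix c d n assume P: "P c n" and cd: "c \<le> d"
    have "c * \<eta> ^ n \<le> d * \<eta> ^ n" using cd eta01 by (intro mult_right_mono) auto
    thus "P d n" using P unfolding P_def by fastforce
  next
    show "eventually (P (4 * (2 * H) / (8 * \<delta>)\<^sup>2 * C)) sequentially"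
      using small
    proof eventually_elim
      case (elim n)
      show ?case unfolding P_def
      proof (intro impI ballI)
        fix z assume z: "z \<in> K"
        define u where "u = 2 * cosh (2 * pi * Im z)"
        have step: "C * \<eta> ^ (n + 1) \<le> C * \<eta> ^ n"
          using C(1) eta01 by (intro mult_left_mono power_decreasing) auto
        have t: "0 \<le> C * \<eta> ^ n" using C(1) eta01 by simp
        have vu: "8 * \<delta> \<le> u" unfolding u_def using cos_ge[OF z, of n] cos_le[of z n] by linarith
        \<comment> \<open>The bound for \<open>n\<close> also holds for the numerator, because \<open>\<eta>\<^sup>n\<close> decreases.\<close>
        have q: "8 * \<delta> - C * \<eta> ^ n \<le> p (n + 1) z" "p (n + 1) z \<le> u + C * \<eta> ^ n"
          using p_bounds[OF z, of "n + 1"] step unfolding u_def by linarith+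
        have "p (n + 1) z / p n z \<le> u / (8 * \<delta>) + 4 * u / (8 * \<delta>)\<^sup>2 * (C * \<eta> ^ n)"
             "8 * \<delta> / u - 4 * u / (8 * \<delta>)\<^sup>2 * (C * \<eta> ^ n) \<le> p (n + 1) z / p n z"
          using quotient_perturbation[OF _ vu t _ p_bounds[OF z, folded u_def] q] delta(2) elim by auto
        moreover have "4 * u / (8 * \<delta>)\<^sup>2 * (C * \<eta> ^ n) \<le> 4 * (2 * H) / (8 * \<delta>)\<^sup>2 * C * \<eta> ^ n"
          unfolding mult.assoc[of _ C]
          using H[OF z] t by (intro mult_right_mono divide_right_mono) (auto simp: u_def)
        moreover have "u / (8 * \<delta>) = cosh (2 * pi * Im z) / (4 * \<delta>)"
             "8 * \<delta> / u = 4 * \<delta> / cosh (2 * pi * Im z)"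
          by (simp_all add: u_def)
        ultimately show "4 * \<delta> / cosh (2 * pi * Im z) - 4 * (2 * H) / (8 * \<delta>)\<^sup>2 * C * \<eta> ^ n \<le> p (n + 1) z / p n z \<and>
            p (n + 1) z / p n z \<le> cosh (2 * pi * Im z) / (4 * \<delta>) + 4 * (2 * H) / (8 * \<delta>)\<^sup>2 * C * \<eta> ^ n"
          by linarith
      qed
    qed
  next
    fix n
    show "\<exists>c. P c n"
    proof (cases "\<forall>z\<in>K. \<beta> n z \<noteq> 1")
      case True
      have "continuous_on K (\<lambda>z. p (n + 1) z / p n z)"
        unfolding p_def beta using True rho1
        by (intro continuous_intros continuous_on_normalized_apostol_bernoulli l) (auto simp: beta)
      then obtain B where "\<And>z. z \<in> K \<Longrightarrow> norm (p (n + 1) z / p n z) \<le> B"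
        using norm_bounded_on_compact[OF K] by blast
      hence B: "p (n + 1) z / p n z \<le> B" if "z \<in> K" for z using that by (simp add: p_def)
      \<comment> \<open>With this \<open>c\<close> the lower bound is at most 0 and the upper bound at least \<open>B\<close>.\<close>
      define c where "c = (\<bar>B\<bar> + 4 * \<delta>) / \<eta> ^ n"
      have c: "c * \<eta> ^ n = \<bar>B\<bar> + 4 * \<delta>" using eta01 by (simp add: c_def)
      have "P c n" unfolding P_def c
      proof (intro impI ballI conjI)
        fix z assume z: "z \<in> K"
        have "4 * \<delta> / cosh (2 * pi * Im z) \<le> 4 * \<delta> / 1"
          using delta(2) cosh_real_ge_1 by (intro divide_left_mono) auto
        moreover have "0 \<le> p (n + 1) z / p n z" by (simp add: p_def)
        ultimately show "4 * \<delta> / cosh (2 * pi * Im z) - (\<bar>B\<bar> + 4 * \<delta>) \<le> p (n + 1) z / p n z"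
          by linarith
        have "0 \<le> cosh (2 * pi * Im z) / (4 * \<delta>)" using delta(2) by simp
        thus "p (n + 1) z / p n z \<le> cosh (2 * pi * Im z) / (4 * \<delta>) + (\<bar>B\<bar> + 4 * \<delta>)"
          using B[OF z] delta(2) by linarith
      qed
      thus ?thesis ..
    qed (auto simp: P_def)
  qed
  then obtain c where c: "c > 0" "\<And>n. P c n" by blast
  have "\<forall>n. (\<forall>z\<in>K. \<beta> n z \<noteq> 1) \<longrightarrow>
        (\<forall>z\<in>K.
          1 / \<rho> * (4 * \<delta> / cosh (2 * pi * Im z) - c * \<eta> ^ n)
            \<le> norm ((\<beta> (n + 1) z - 1) / (\<beta> n z - 1)) \<and>
          norm ((\<beta> (n + 1) z - 1) / (\<beta> n z - 1))
            \<le> 1 / \<rho> * (cosh (2 * pi * Im z) / (4 * \<delta>) + c * \<eta> ^ n))"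
    unfolding ratio
  proof (intro allI impI ballI conjI mult_left_mono)
    fix n z assume "\<forall>z\<in>K. \<beta> n z \<noteq> 1" "z \<in> K"
    thus "4 * \<delta> / cosh (2 * pi * Im z) - c * \<eta> ^ n \<le> p (n + 1) z / p n z"
         "p (n + 1) z / p n z \<le> cosh (2 * pi * Im z) / (4 * \<delta>) + c * \<eta> ^ n"
      using c(2)[of n] unfolding P_def by blast+
  qed (use rho1 in auto)
  with c(1) ne rho' rho1 rhomu eta01 show ?thesis by blast
qed

end
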